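(* For any subset $A\subseteq\mathbb{N}$: (i) $A$ is finite if, and only if, $\mathrm{Cont}(A)=\emptyset$. (ii) $A$ is cofinite if, and only if, $\mathrm{Cont}(A)\in\mathbf{J}_{\neg\neg}$.
   Context: $\mathbb{M}$ is the monoid, under composition, of all maps $f:\mathbb{N}\to\mathbb{N}$ that are finite, i.e. such that the fiber $f^{-1}(n)$ is finite for every $n\in\mathbb{N}$. An ideal of $\mathbb{M}$ is a right ideal: a (possibly empty) subset $I\subseteq\mathbb{M}$ such that $f\in I$ and $g\in\mathbb{M}$ imply $f\circ g\in I$. For $A\subseteq\mathbb{N}$, the content of $A$ is the ideal $\mathrm{Cont}(A)=\{f\in\mathbb{M};\ \mathrm{Im}(f)\subseteq A\}$. The double negation topology on $\mathbb{M}$ is the set of ideals $$\mathbf{J}_{\neg\neg}=\{I \text{ ideal of }\mathbb{M};\ \forall f\in\mathbb{M},\ \exists g\in\mathbb{M},\ f\circ g\in I\}.$$ A subset of $\mathbb{N}$ is cofinite if its complement in $\mathbb{N}$ is finite. *)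

theory Defs
  imports Main
begin

definition finite_maps :: "(nat \<Rightarrow> nat) set"  ("\<M>")
  where "\<M> = {f. \<forall>n. finite (f -` {n})}"

lemma id_in_finite_maps: "id \<in> \<M>"
  by (simp add: finite_maps_def)

lemma comp_in_finite_maps:
  assumes f: "f \<in> \<M>" and g: "g \<in> \<M>"
  shows "f \<circ> g \<in> \<M>"
proof -
  have "finite ((f \<circ> g) -` {n})" for n
  proof -
    have "(f \<circ> g) -` {n} = (\<Union>m \<in> f -` {n}. g -` {m})"
      by auto
    then show ?thesis
      using f g by (simp add: finite_maps_def)
  qed
  then show ?thesis
    by (simp add: finite_maps_def)
qed

text \<open>Ideals are right ideals; the empty set is allowed.\<close>

definition is_ideal :: "(nat \<Rightarrow> nat) set \<Rightarrow> bool"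
  where "is_ideal I \<longleftrightarrow> I \<subseteq> \<M> \<and> (\<forall>f\<in>I. \<forall>g\<in>\<M>. f \<circ> g \<in> I)"

definition Cont :: "nat set \<Rightarrow> (nat \<Rightarrow> nat) set"
  where "Cont A = {f \<in> \<M>. range f \<subseteq> A}"

lemma is_ideal_Cont: "is_ideal (Cont A)"
  unfolding is_ideal_def Cont_def by (auto intro: comp_in_finite_maps)

definition double_neg_topology :: "(nat \<Rightarrow> nat) set set"  ("J\<^sub>\<not>\<^sub>\<not>")
  where "J\<^sub>\<not>\<^sub>\<not> = {I. is_ideal I \<and> (\<forall>f\<in>\<M>. \<exists>g\<in>\<M>. f \<circ> g \<in> I)}"

end

theory Submission
  imports Defs
begin

text \<open>
  Both equivalences come from one observation: an infinite set of natural numbers is the range of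
  an injection, which is a finite map, whereas a finite map has infinite range because its domain
  is infinite and its fibers are not. This is part (i).

  For part (ii), \<open>f \<circ> g\<close> has its range in \<open>A\<close> exactly when \<open>g\<close> has its range in \<open>f -` A\<close>. By (i), a
  suitable \<open>g\<close> exists exactly when \<open>f -` A\<close> is infinite, so the content of \<open>A\<close> is a cover for the double
  negation topology if and only if all preimages of \<open>A\<close> under finite maps are infinite. They are
  when \<open>- A\<close> is finite, since \<open>f -` (- A)\<close> is then finite too. When \<open>- A\<close> is infinite, a finite map
  into \<open>- A\<close> pulls \<open>A\<close> back to the empty set.
\<close>

lemma finite_vimage_finite_maps:
  assumes "f \<in> \<M>" and "finite A"
  shows "finite (f -` A)"
proof -
  have "f -` A = (\<Union>a\<in>A. f -` {a})"
    by auto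
  then show ?thesis
    using assms by (simp add: finite_maps_def)
qed

lemma inj_in_finite_maps: "inj f \<Longrightarrow> f \<in> \<M>"
  by (simp add: finite_maps_def finite_vimageI)

lemma Cont_eq_empty_iff: "Cont A = {} \<longleftrightarrow> finite A"
proof
  assume "Cont A = {}"
  show "finite A"
  proof (rule ccontr)
    assume "infinite A"
    then obtain f :: "nat \<Rightarrow> nat" where "inj f" "range f \<subseteq> A"
      using infinite_countable_subset by blast
    then have "f \<in> Cont A"
      by (simp add: Cont_def inj_in_finite_maps)
    with \<open>Cont A = {}\<close> show False
      by simp
  qed
next
  assume "finite A"
  have False if "f \<in> Cont A" for f
  proof -
    have "f \<in> \<M>" "f -` A = UNIV"
      using that by (auto simp: Cont_def)
    then show False
      using finite_vimage_finite_maps [OF _ \<open>finite A\<close>] by fastforce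
  qed
  then show "Cont A = {}"
    by blast
qed

lemma comp_in_Cont_iff:
  assumes "f \<in> \<M>" and "g \<in> \<M>"
  shows "f \<circ> g \<in> Cont A \<longleftrightarrow> g \<in> Cont (f -` A)"
  using assms comp_in_finite_maps by (auto simp: Cont_def)

text \<open>By \<open>comp_in_Cont_iff\<close>, the maps \<open>g\<close> that the topology asks for at \<open>f\<close> are the members of
  \<open>Cont (f -` A)\<close>, so that \<open>Cont_eq_empty_iff\<close> decides whether there is one.\<close>

lemma Cont_in_double_neg_topology_iff:
  "Cont A \<in> J\<^sub>\<not>\<^sub>\<not> \<longleftrightarrow> (\<forall>f\<in>\<M>. infinite (f -` A))"
proof -
  have "(\<exists>g\<in>\<M>. f \<circ> g \<in> Cont A) \<longleftrightarrow> infinite (f -` A)" if "f \<in> \<M>" for f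
  proof -
    have "(\<exists>g\<in>\<M>. f \<circ> g \<in> Cont A) \<longleftrightarrow> (\<exists>g\<in>\<M>. g \<in> Cont (f -` A))"
      using that comp_in_Cont_iff by blast
    also have "\<dots> \<longleftrightarrow> Cont (f -` A) \<noteq> {}"
      by (auto simp: Cont_def)
    finally show ?thesis
      by (simp add: Cont_eq_empty_iff)
  qed
  then show ?thesis
    by (simp add: double_neg_topology_def is_ideal_Cont)
qed

lemma infinite_vimages_iff_cofinite:
  "(\<forall>f\<in>\<M>. infinite (f -` A)) \<longleftrightarrow> finite (- A)"
proof
  assume infinite_vimages: "\<forall>f\<in>\<M>. infinite (f -` A)"
  show "finite (- A)"
  proof (rule ccontr)
    assume "infinite (- A)"
    then obtain f where "f \<in> Cont (- A)"
      using Cont_eq_empty_iff by blast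
    then have "f \<in> \<M>" "f -` A = {}"
      by (auto simp: Cont_def)
    with infinite_vimages show False
      by fastforce
  qed
next
  assume "finite (- A)"
  then have "finite (- (f -` A))" if "f \<in> \<M>" for f
    using finite_vimage_finite_maps [OF that] by (simp flip: vimage_Compl)
  then show "\<forall>f\<in>\<M>. infinite (f -` A)"
    using finite_compl infinite_UNIV_nat by blast
qed

theorem theorem2p10:
  fixes A :: "nat set"
  shows "(finite A \<longleftrightarrow> Cont A = {}) \<and>
         (finite (- A) \<longleftrightarrow> Cont A \<in> J\<^sub>\<not>\<^sub>\<not>)"
  by (simp add: Cont_eq_empty_iff Cont_in_double_neg_topology_iff infinite_vimages_iff_cofinite)

end
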